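(* Let $(L,[\cdot,\cdot],\alpha,\beta)$ be a BiHom-Lie superalgebra over a field $k$ with $\alpha$ and $\beta$ bijective, let $a\in L$ be a homogeneous element satisfying $\alpha(a)=a=\beta(a)$, and let $k\ge 0$ be an integer. Then the map $ad_k(a):L\to L$ defined by $ad_k(a)(x)=[a,\beta^{k}(x)]$ for all $x\in L$ is a $\beta^{k+1}$-derivation of $L$ (homogeneous of degree $|a|$).
   Context: All spaces are over a fixed base field. A superspace is a $\mathbb{Z}_2$-graded vector space $V=V_0\oplus V_1$; the parity of a homogeneous $x$ is denoted $|x|$. Even (bi)linear maps are those respecting the grading. A BiHom-Lie superalgebra is a 4-tuple $(L,[\cdot,\cdot],\alpha,\beta)$ where $L$ is a superspace, $\alpha,\beta:L\to L$ are even linear maps and $[\cdot,\cdot]:L\otimes L\to L$ is an even bilinear map such that for all homogeneous $x,y,z\in L$: $\alpha\circ\beta=\beta\circ\alpha$; $\alpha[x,y]=[\alpha(x),\alpha(y)]$ and $\beta[x,y]=[\beta(x),\beta(y)]$; $[\beta(x),\alpha(y)]=-(-1)^{|x||y|}[\beta(y),\alpha(x)]$; and $\circlearrowleft_{x,y,z}(-1)^{|x||z|}[\beta^{2}(x),[\beta(y),\alpha(z)]]=0$, where $\circlearrowleft_{x,y,z}$ is the sum over cyclic permutations of $(x,y,z)$. For an integer $m\ge 0$, $\beta^m$ is the $m$-fold composition of $\beta$ (with $\beta^0=\mathrm{id}$). A homogeneous linear map $D:L\to L$ of degree $|D|$ is a $\beta^{m}$-derivation of $L$ if $D\circ\alpha=\alpha\circ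 D$, $D\circ\beta=\beta\circ D$, and $$D[x,y]=[D(x),\beta^{m}(y)]+(-1)^{|x||D|}[\beta^{m}(x),D(y)]$$ for all homogeneous $x,y\in L$. *)

theory Defs
  imports Complex_Main "HOL-Library.Z2"
begin

text \<open>
  Degrees live in \<^typ>\<open>bit\<close>, the field with two elements: \<open>V 0\<close> and \<open>V 1\<close> are the even and
  the odd part, and products of parities are products in this field. The zero vector belongs to
  both parts, hence is homogeneous of either parity.
\<close>

locale superspace = vector_space scale
  for scale :: "'k::field \<Rightarrow> 'v::ab_group_add \<Rightarrow> 'v"
    and V :: "bit \<Rightarrow> 'v set" +
  assumes subspace_component: "subspace (V i)"
    and components_span: "\<exists>x\<in>V 0. \<exists>y\<in>V 1. v = x + y"
    and components_independent: "V 0 \<inter> V 1 = {0}"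

definition parity_sign :: "bit \<Rightarrow> 'k::field" where
  "parity_sign p = (- 1) ^ (of_bit p :: nat)"

definition homogeneous_linear ::
  "('k::field \<Rightarrow> 'v::ab_group_add \<Rightarrow> 'v) \<Rightarrow> (bit \<Rightarrow> 'v set) \<Rightarrow> bit \<Rightarrow> ('v \<Rightarrow> 'v) \<Rightarrow> bool" where
  "homogeneous_linear scale V d f \<longleftrightarrow>
     Vector_Spaces.linear scale scale f \<and> (\<forall>i. \<forall>x\<in>V i. f x \<in> V (i + d))"

definition even_bilinear ::
  "('k::field \<Rightarrow> 'v::ab_group_add \<Rightarrow> 'v) \<Rightarrow> (bit \<Rightarrow> 'v set) \<Rightarrow> ('v \<Rightarrow> 'v \<Rightarrow> 'v) \<Rightarrow> bool" where
  "even_bilinear scale V br \<longleftrightarrow>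
     (\<forall>x. Vector_Spaces.linear scale scale (\<lambda>y. br x y)) \<and>
     (\<forall>y. Vector_Spaces.linear scale scale (\<lambda>x. br x y)) \<and>
     (\<forall>i j. \<forall>x\<in>V i. \<forall>y\<in>V j. br x y \<in> V (i + j))"

locale bihom_lie_superalgebra = superspace scale V
  for scale :: "'k::field \<Rightarrow> 'v::ab_group_add \<Rightarrow> 'v"
    and V :: "bit \<Rightarrow> 'v set"
    and br :: "'v \<Rightarrow> 'v \<Rightarrow> 'v"
    and \<alpha> \<beta> :: "'v \<Rightarrow> 'v" +
  assumes even_alpha: "homogeneous_linear scale V 0 \<alpha>"
    and even_beta: "homogeneous_linear scale V 0 \<beta>"
    and even_bracket: "even_bilinear scale V br"
    and alpha_beta_commute: "\<alpha> \<circ> \<beta> = \<beta> \<circ> \<alpha>"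
    and alpha_bracket: "\<lbrakk>x \<in> V i; y \<in> V j\<rbrakk> \<Longrightarrow> \<alpha> (br x y) = br (\<alpha> x) (\<alpha> y)"
    and beta_bracket: "\<lbrakk>x \<in> V i; y \<in> V j\<rbrakk> \<Longrightarrow> \<beta> (br x y) = br (\<beta> x) (\<beta> y)"
    and super_skew:
      "\<lbrakk>x \<in> V i; y \<in> V j\<rbrakk> \<Longrightarrow>
         br (\<beta> x) (\<alpha> y) = - scale (parity_sign (i * j)) (br (\<beta> y) (\<alpha> x))"
    and super_jacobi:
      "\<lbrakk>x \<in> V i; y \<in> V j; z \<in> V l\<rbrakk> \<Longrightarrow>
         scale (parity_sign (i * l)) (br ((\<beta> ^^ 2) x) (br (\<beta> y) (\<alpha> z)))
       + scale (parity_sign (j * i)) (br ((\<beta> ^^ 2) y) (br (\<beta> z) (\<alpha> x)))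
       + scale (parity_sign (l * j)) (br ((\<beta> ^^ 2) z) (br (\<beta> x) (\<alpha> y))) = 0"

definition (in bihom_lie_superalgebra) is_beta_derivation :: "nat \<Rightarrow> bit \<Rightarrow> ('v \<Rightarrow> 'v) \<Rightarrow> bool" where
  "is_beta_derivation m d D \<longleftrightarrow>
     homogeneous_linear scale V d D \<and>
     D \<circ> \<alpha> = \<alpha> \<circ> D \<and>
     D \<circ> \<beta> = \<beta> \<circ> D \<and>
     (\<forall>i j. \<forall>x\<in>V i. \<forall>y\<in>V j.
        D (br x y) = br (D x) ((\<beta> ^^ m) y)
                   + scale (parity_sign (i * d)) (br ((\<beta> ^^ m) x) (D y)))"

definition (in bihom_lie_superalgebra) ad :: "nat \<Rightarrow> 'v \<Rightarrow> 'v \<Rightarrow> 'v" where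
  "ad k a x = br a ((\<beta> ^^ k) x)"

end

theory Submission
  imports Defs
begin

text \<open>
  Put \<open>X = \<beta>\<^sup>k x\<close> and \<open>Y = \<beta>\<^sup>k y\<close>. Since \<open>\<alpha>\<close> and \<open>\<beta>\<close> fix \<open>a\<close>, the derivation rule is the
  Leibniz form \<open>[a, [X, Y]] = [[a, X], \<beta> Y] + (-1)\<^bsup>|x||a|\<^esup> [\<beta> X, [a, Y]]\<close> of the Jacobi
  identity. It comes from the cyclic form for the triple \<open>a\<close>, \<open>\<beta>\<^sup>-\<^sup>1 X\<close>, \<open>\<alpha>\<^sup>-\<^sup>1 Y\<close>, which is
  homogeneous because the inverse of an even bijection is even; skew-supersymmetry then
  exchanges \<open>Y\<close> with \<open>a\<close> in one term and with \<open>[a, X]\<close> in the other.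
\<close>

lemma homogeneous_linear_0_iff:
  "homogeneous_linear scale V 0 f \<longleftrightarrow>
    Vector_Spaces.linear scale scale f \<and> (\<forall>i. \<forall>x\<in>V i. f x \<in> V i)"
  by (simp only: homogeneous_linear_def add_0_right)

lemma homogeneous_linear_funpow:
  assumes "homogeneous_linear scale V 0 f"
  shows "homogeneous_linear scale V 0 (f ^^ n)"
proof (induction n)
  case 0
  from assms have "vector_space scale"
    by (simp add: homogeneous_linear_def Vector_Spaces.linear_iff)
  then show ?case
    by (simp add: homogeneous_linear_0_iff vector_space.linear_ident)
next
  case (Suc n)
  with assms show ?case
    unfolding homogeneous_linear_0_iff funpow.simps
    by (metis Vector_Spaces.linear_compose comp_apply)
qed

context superspace
begin

text \<open>\<open>i + 1\<close> is the opposite parity, so this form and the next one treat both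
  parities at once.\<close>

lemma components_disjoint: "x \<in> V i \<Longrightarrow> x \<in> V (i + 1) \<Longrightarrow> x = 0"
  using components_independent by (cases i) auto

lemma components_span_at: "\<exists>x\<in>V i. \<exists>y\<in>V (i + 1). v = x + y"
  using components_span[of v] by (cases i) (auto, metis add.commute)

text \<open>Split \<open>v\<close> into \<open>x\<close> of parity \<open>i\<close> and
  \<open>y\<close> of the opposite parity. Then \<open>f y = f v - f x\<close> lies in both
  components, so it vanishes, and injectivity gives \<open>y = 0\<close>.\<close>

lemma even_bij_reflects_component:
  assumes f: "homogeneous_linear scale V 0 f" and "inj f" and "f v \<in> V i"
  shows "v \<in> V i"
proof -
  obtain x y where xy: "x \<in> V i" "y \<in> V (i + 1)" "v = x + y"
    using components_span_at by blast
  from f have lin: "Vector_Spaces.linear scale scale f"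
    and even: "\<And>j u. u \<in> V j \<Longrightarrow> f u \<in> V j"
    by (auto simp: homogeneous_linear_0_iff)
  interpret f: Vector_Spaces.linear scale scale f by (rule lin)
  have "f y = f v - f x"
    by (simp add: xy f.add)
  also have "\<dots> \<in> V i"
    using assms(3) even[OF xy(1)] subspace_component by (intro subspace_diff)
  finally have "f y = 0"
    using components_disjoint even[OF xy(2)] by blast
  with \<open>inj f\<close> have "y = 0"
    by (metis f.zero injD)
  with xy show ?thesis by simp
qed

lemma even_bij_preimage:
  assumes "homogeneous_linear scale V 0 f" and "bij f" and "v \<in> V i"
  obtains u where "u \<in> V i" and "v = f u"
  using assms even_bij_reflects_component by (metis bij_def surjD)

text \<open>The axioms make \<alpha> and \<beta> multiplicative on homogeneous elements only,
  whereas a derivation has to commute with them as maps on the whole space; this bridges the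
  gap.\<close>

lemma linear_eq_on_components:
  assumes "Vector_Spaces.linear scale scale f" and "Vector_Spaces.linear scale scale g"
    and "\<And>i x. x \<in> V i \<Longrightarrow> f x = g x"
  shows "f = g"
proof
  fix v
  obtain x y where "x \<in> V 0" "y \<in> V 1" "v = x + y"
    using components_span by blast
  with assms show "f v = g v"
    by (simp add: Vector_Spaces.linear_iff)
qed

end

context bihom_lie_superalgebra
begin

lemma linear_br: "Vector_Spaces.linear scale scale (br x)"
  and br_component: "x \<in> V i \<Longrightarrow> y \<in> V j \<Longrightarrow> br x y \<in> V (i + j)"
  using even_bracket by (auto simp: even_bilinear_def)

lemma br_scale: "br x (scale c y) = scale c (br x y)"
  and br_uminus: "br x (- y) = - br x y"
proof -
  interpret Vector_Spaces.linear scale scale "br x" by (rule linear_br)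
  show "br x (scale c y) = scale c (br x y)" "br x (- y) = - br x y"
    by (rule scale, rule neg)
qed

lemma alpha_component: "x \<in> V i \<Longrightarrow> \<alpha> x \<in> V i"
  and beta_component: "x \<in> V i \<Longrightarrow> \<beta> x \<in> V i"
  and linear_alpha: "Vector_Spaces.linear scale scale \<alpha>"
  and linear_beta: "Vector_Spaces.linear scale scale \<beta>"
  using even_alpha even_beta by (auto simp: homogeneous_linear_0_iff)

lemma beta_pow_component: "x \<in> V i \<Longrightarrow> (\<beta> ^^ n) x \<in> V i"
  and linear_beta_pow: "Vector_Spaces.linear scale scale (\<beta> ^^ n)"
  using homogeneous_linear_funpow[OF even_beta] by (auto simp: homogeneous_linear_0_iff)

lemma alpha_beta: "\<alpha> (\<beta> x) = \<beta> (\<alpha> x)"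
  using alpha_beta_commute by (metis comp_apply)

lemma alpha_beta_pow: "\<alpha> ((\<beta> ^^ n) x) = (\<beta> ^^ n) (\<alpha> x)"
  by (induction n) (simp_all add: alpha_beta)

lemma beta_pow_bracket:
  "x \<in> V i \<Longrightarrow> y \<in> V j \<Longrightarrow> (\<beta> ^^ n) (br x y) = br ((\<beta> ^^ n) x) ((\<beta> ^^ n) y)"
  by (induction n) (simp_all add: beta_bracket[OF beta_pow_component beta_pow_component])

lemma jacobi_leibniz:
  assumes "bij \<alpha>" and "bij \<beta>" and a: "a \<in> V d" "\<alpha> a = a" "\<beta> a = a"
    and X: "X \<in> V i" and Y: "Y \<in> V j"
  shows "br a (br X Y)
    = br (br a X) (\<beta> Y) + scale (parity_sign (i * d)) (br (\<beta> X) (br a Y))"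
proof -
  \<comment> \<open>Inner brackets of the Jacobi identity have the form
    \<open>br (\<beta> u) (\<alpha> w)\<close>; preimages bring \<open>br X Y\<close> into this
    shape.\<close>
  obtain x where x: "x \<in> V i" "X = \<beta> x"
    using even_bij_preimage[OF even_beta \<open>bij \<beta>\<close> X] .
  obtain y where y: "y \<in> V j" "Y = \<alpha> y"
    using even_bij_preimage[OF even_alpha \<open>bij \<alpha>\<close> Y] .
  let ?s = "parity_sign :: bit \<Rightarrow> 'k"
  have skew_Y: "br (\<beta> y) a = - scale (?s (j * d)) (br a Y)"
    using super_skew[OF y(1) a(1)] a y by simp
  \<comment> \<open>Skew-supersymmetry needs \<alpha> outermost in the second argument. As \<alpha>
    fixes \<open>a\<close>, it can be pulled out, leaving \<open>br a x\<close> of degree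
    \<open>d + i\<close>.\<close>
  have "br (\<beta> (\<beta> y)) (br a (\<alpha> x)) = br (\<beta> (\<beta> y)) (\<alpha> (br a x))"
    using alpha_bracket[OF a(1) x(1)] a by simp
  also have "\<dots> = - scale (?s (j * (d + i))) (br (\<beta> (br a x)) (\<alpha> (\<beta> y)))"
    by (rule super_skew[OF beta_component[OF y(1)] br_component[OF a(1) x(1)]])
  also have "\<beta> (br a x) = br a X"
    using beta_bracket[OF a(1) x(1)] a x by simp
  also have "\<alpha> (\<beta> y) = \<beta> Y"
    using y by (simp add: alpha_beta)
  finally have skew_X:
    "br (\<beta> (\<beta> y)) (br a (\<alpha> x)) = - scale (?s (j * (d + i))) (br (br a X) (\<beta> Y))" .
  \<comment> \<open>The exponent \<open>j * i\<close> occurs twice and cancels, so the third Jacobi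
    term also carries the sign \<open>?s (d * j)\<close>.\<close>
  have signs: "?s (j * i) * ?s (j * (d + i)) = ?s (d * j)"
    by (cases i; cases j; cases d) (simp_all add: parity_sign_def)
  \<comment> \<open>The Jacobi identity for \<open>a\<close>, \<open>x\<close>, \<open>y\<close>,
    with its second term rewritten by \<open>skew_Y\<close> and its third by \<open>skew_X\<close>.
    All three terms now share the factor \<open>?s (d * j)\<close>, which is 1 or -1 and can be
    cancelled.\<close>
  have "scale (?s (d * j)) (br a (br X Y))
      + - scale (?s (d * j) * ?s (i * d)) (br (\<beta> X) (br a Y))
      + - scale (?s (d * j)) (br (br a X) (\<beta> Y)) = 0"
    using super_jacobi[OF a(1) x(1) y(1)]
    by (simp only: numeral_2_eq_2 funpow.simps comp_apply id_apply a skew_Y skew_X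
        br_scale br_uminus scale_minus_right scale_scale signs
        mult.commute[of "?s (i * d)"] mult.commute[of j d] flip: x(2) y(2))
  then have "scale (?s (d * j))
      (br a (br X Y) - scale (?s (i * d)) (br (\<beta> X) (br a Y)) - br (br a X) (\<beta> Y)) = 0"
    by (simp only: scale_right_distrib scale_minus_right scale_scale diff_conv_add_uminus)
  moreover have "?s (d * j) \<noteq> 0"
    by (simp add: parity_sign_def)
  ultimately have
    "br a (br X Y) - scale (?s (i * d)) (br (\<beta> X) (br a Y)) - br (br a X) (\<beta> Y) = 0"
    by (simp only: scale_eq_0_iff simp_thms)
  then show ?thesis
    by (simp only: diff_diff_eq eq_iff_diff_eq_0[symmetric] add.commute)
qed

text \<open>The even map \<open>\<beta> ^^ k\<close> is followed by \<open>br a\<close>, which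
  shifts degrees by \<open>d\<close>.\<close>

lemma ad_homogeneous_linear:
  assumes "a \<in> V d"
  shows "homogeneous_linear scale V d (ad k a)"
proof -
  have "Vector_Spaces.linear scale scale (br a \<circ> (\<beta> ^^ k))"
    by (rule Vector_Spaces.linear_compose[OF linear_beta_pow linear_br])
  moreover have "br a \<circ> (\<beta> ^^ k) = ad k a"
    by (simp add: fun_eq_iff ad_def)
  ultimately show ?thesis
    using br_component[OF assms beta_pow_component]
    by (auto simp only: homogeneous_linear_def ad_def add.commute[of d])
qed

lemma ad_is_beta_derivation:
  assumes "bij \<alpha>" and "bij \<beta>" and a: "a \<in> V d" "\<alpha> a = a" "\<beta> a = a"
  shows "is_beta_derivation (k + 1) d (ad k a)"
  unfolding is_beta_derivation_def
proof (intro conjI allI ballI)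
  have lin: "Vector_Spaces.linear scale scale (ad k a)"
    using ad_homogeneous_linear[OF a(1)] by (simp add: homogeneous_linear_def)
  show "ad k a \<circ> \<alpha> = \<alpha> \<circ> ad k a"
  proof (rule linear_eq_on_components)
    show "(ad k a \<circ> \<alpha>) x = (\<alpha> \<circ> ad k a) x" if "x \<in> V i" for i x
      using alpha_bracket[OF a(1) beta_pow_component[OF that]] a
      by (simp add: ad_def alpha_beta_pow)
  qed (rule Vector_Spaces.linear_compose[OF linear_alpha lin]
      Vector_Spaces.linear_compose[OF lin linear_alpha])+
  show "ad k a \<circ> \<beta> = \<beta> \<circ> ad k a"
  proof (rule linear_eq_on_components)
    show "(ad k a \<circ> \<beta>) x = (\<beta> \<circ> ad k a) x" if "x \<in> V i" for i x
      using beta_bracket[OF a(1) beta_pow_component[OF that]] a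
      by (simp add: ad_def funpow_swap1)
  qed (rule Vector_Spaces.linear_compose[OF linear_beta lin]
      Vector_Spaces.linear_compose[OF lin linear_beta])+
  \<comment> \<open>The Leibniz form is used at \<open>(\<beta> ^^ k) x\<close> and
    \<open>(\<beta> ^^ k) y\<close>; the extra \<beta> in it raises the exponent to
    \<open>k + 1\<close>.\<close>
  show "ad k a (br x y) = br (ad k a x) ((\<beta> ^^ (k + 1)) y)
      + scale (parity_sign (i * d)) (br ((\<beta> ^^ (k + 1)) x) (ad k a y))"
    if "x \<in> V i" "y \<in> V j" for i j x y
    using jacobi_leibniz[OF assms beta_pow_component[OF that(1)] beta_pow_component[OF that(2)]]
    by (simp add: ad_def beta_pow_bracket[OF that])
qed (rule ad_homogeneous_linear[OF a(1)])

end

theorem proposition4p5: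
  fixes scale :: "'k::field \<Rightarrow> 'v::ab_group_add \<Rightarrow> 'v"
    and V :: "bit \<Rightarrow> 'v set"
    and br :: "'v \<Rightarrow> 'v \<Rightarrow> 'v"
    and \<alpha> \<beta> :: "'v \<Rightarrow> 'v"
    and a :: 'v and d :: bit and k :: nat
  assumes "bihom_lie_superalgebra scale V br \<alpha> \<beta>"
    and "bij \<alpha>" and "bij \<beta>"
    and "a \<in> V d"
    and "\<alpha> a = a" and "\<beta> a = a"
  shows "bihom_lie_superalgebra.is_beta_derivation scale V br \<alpha> \<beta> (k + 1) d
           (bihom_lie_superalgebra.ad br \<beta> k a)"
  using assms by (rule bihom_lie_superalgebra.ad_is_beta_derivation)

end
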